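(* Let $(\mathfrak g,[\cdot,\cdot,\cdot]_{\mathfrak g})$ be a Lie triple system and set $\pi(x,y,z)=[x,y,z]_{\mathfrak g}$. Let $\delta:C^n_{\mathsf{LTS}}(\mathfrak g;\mathfrak g)\to C^{n+1}_{\mathsf{LTS}}(\mathfrak g;\mathfrak g)$ be the coboundary operator of the Lie triple system with coefficients in the adjoint representation, and let $\llbracket\cdot,\cdot\rrbracket$ be the bracket defined in the context. Then for all $n=1,2,\dots$ and all $f\in C^n_{\mathsf{LTS}}(\mathfrak g;\mathfrak g)$, $$\delta f=(-1)^{n-1}\llbracket\pi,f\rrbracket .$$
   Context: **Lie triple system.** A vector space $\mathfrak g$ with a linear map $[\cdot,\cdot,\cdot]_{\mathfrak g}:\otimes^3\mathfrak g\to\mathfrak g$ such that $[x,x,y]_{\mathfrak g}=0$; $[x,y,z]_{\mathfrak g}+[y,z,x]_{\mathfrak g}+[z,x,y]_{\mathfrak g}=0$; $[x,y,[z,w,u]_{\mathfrak g}]_{\mathfrak g}=[[x,y,z]_{\mathfrak g},w,u]_{\mathfrak g}+[z,[x,y,w]_{\mathfrak g},u]_{\mathfrak g}+[z,w,[x,y,u]_{\mathfrak g}]_{\mathfrak g}$. **Cochains and coboundary.** For $\mathfrak X_i=x_i\otimes y_i\in\otimes^2\mathfrak g$ write $[\mathfrak X_i,z]_{\mathfrak g}=[x_i,y_i,z]_{\mathfrak g}$ and $[x\otimes y,z\otimes w]=[x,y,z]_{\mathfrak g}\otimes w+z\otimes[x,y,w]_{\mathfrak g}$. For $n\ge1$,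 $C^n_{\mathsf{LTS}}(\mathfrak g;\mathfrak g)$ is the space of linear maps $f:\otimes^{2n-1}\mathfrak g\to\mathfrak g$ which satisfy (the conditions being void for $n=1$) $f(\mathfrak X_1,\dots,\mathfrak X_{n-2},x,x,y)=0$ and $f(\mathfrak X_1,\dots,\mathfrak X_{n-2},x,y,z)+f(\mathfrak X_1,\dots,\mathfrak X_{n-2},y,z,x)+f(\mathfrak X_1,\dots,\mathfrak X_{n-2},z,x,y)=0$. The adjoint representation is $\rho=\mathrm{ad}:\otimes^2\mathfrak g\to\mathfrak{gl}(\mathfrak g)$, $\rho(x,y)z=\mathrm{ad}_{x,y}z=[z,x,y]_{\mathfrak g}$. The coboundary operator is $$\begin{aligned}(\delta f)(\mathfrak X_1,\dots,\mathfrak X_n,z)=&\sum_{1\le j<k\le n}(-1)^jf(\mathfrak X_1,\dots,\hat{\mathfrak X}_j,\dots,\mathfrak X_{k-1},[\mathfrak X_j,\mathfrak X_k],\mathfrak X_{k+1},\dots,\mathfrak X_n,z)\\&+\sum_{j=1}^n(-1)^jf(\mathfrak X_1,\dots,\hat{\mathfrak X}_j,\dots,\mathfrak X_n,[\mathfrak X_j,z]_{\mathfrak g})\\&+\sum_{j=1}^n(-1)^{j+1}\big(\rho(y_j,x_j)-\rho(x_j,y_j)\big)f(\mathfrak X_1,\dots,\hat{\mathfrak X}_j,\dots,\mathfrak X_n,z)\\&+(-1)^{n+1}\big(\rho(y_n,z)f(\mathfrak X_1,\dots,\mathfrak X_{n-1},x_n)-\rho(x_n,z)f(\mathfrak X_1,\dots,\mathfrak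 X_{n-1},y_n)\big).\end{aligned}$$ **The bracket.** Let $C^p(\mathfrak g,\mathfrak g)=\mathrm{Hom}(\otimes^{2p+1}\mathfrak g,\mathfrak g)$, with degree $p$; thus $f\in C^n_{\mathsf{LTS}}(\mathfrak g;\mathfrak g)$ has degree $n-1$ and $\pi$ has degree $1$. Let $\mathbb S_{(a,b)}$ be the set of permutations $\sigma$ of $\{1,\dots,a+b\}$ with $\sigma(1)<\cdots<\sigma(a)$ and $\sigma(a+1)<\cdots<\sigma(a+b)$, and $(-1)^\sigma$ the sign of $\sigma$. For $P\in C^p(\mathfrak g,\mathfrak g)$, $Q\in C^q(\mathfrak g,\mathfrak g)$, $$\llbracket P,Q\rrbracket=P\circ Q-(-1)^{pq}Q\circ P,\qquad P\circ Q=\sum_{k=1}^{p+1}(-1)^{(k-1)q}P\circ_kQ,$$ where for $k=1,\dots,p$ $$\begin{aligned}(P\circ_kQ)(\mathfrak X_1,\dots,\mathfrak X_{p+q},x)=&\sum_{\sigma\in\mathbb S_{(k-1,q)}}(-1)^\sigma P\big(\mathfrak X_{\sigma(1)},\dots,\mathfrak X_{\sigma(k-1)},Q(\mathfrak X_{\sigma(k)},\dots,\mathfrak X_{\sigma(k+q-1)},x_{k+q})\otimes y_{k+q},\mathfrak X_{k+q+1},\dots,\mathfrak X_{p+q},x\big)\\&+\sum_{\sigma\in\mathbb S_{(k-1,q)}}(-1)^\sigma P\big(\mathfrak X_{\sigma(1)},\dots,\mathfrak X_{\sigma(k-1)},x_{k+q}\otimes Q(\mathfrak X_{\sigma(k)},\dots,\mathfrak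 X_{\sigma(k+q-1)},y_{k+q}),\mathfrak X_{k+q+1},\dots,\mathfrak X_{p+q},x\big),\end{aligned}$$ and $$(P\circ_{p+1}Q)(\mathfrak X_1,\dots,\mathfrak X_{p+q},x)=\sum_{\sigma\in\mathbb S_{(p,q)}}(-1)^\sigma P\big(\mathfrak X_{\sigma(1)},\dots,\mathfrak X_{\sigma(p)},Q(\mathfrak X_{\sigma(p+1)},\dots,\mathfrak X_{\sigma(p+q)},x)\big).$$ *)

theory Defs
  imports Complex_Main "HOL-Combinatorics.Permutations"
begin

text \<open>
  Conventions.  The ground field is an arbitrary \<open>'k :: field\<close> acting on \<open>'v\<close> by \<open>scale\<close>.
  A linear map on the tensor power of order \<open>2p + 1\<close> is represented by the multilinear map
  obtained by restricting it to decomposable tensors, as a function of the list of the \<open>p\<close> pairs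
  \<open>(x\<^sub>i, y\<^sub>i)\<close> standing for \<open>x\<^sub>i \<otimes> y\<^sub>i\<close>, and of the last argument.  Only its values at lists of
  length \<open>p\<close> are meaningful, so two such maps are equal iff they agree on these lists.  The value
  at a sum of decomposable tensors is the sum of the values.
\<close>

type_synonym 'v cochain = "('v \<times> 'v) list \<Rightarrow> 'v \<Rightarrow> 'v"

definition Hom_tensor :: "('k::field \<Rightarrow> 'v::ab_group_add \<Rightarrow> 'v) \<Rightarrow> nat \<Rightarrow> 'v cochain set" where
  "Hom_tensor scale p = {f. \<forall>Xs. length Xs = p \<longrightarrow>
     Vector_Spaces.linear scale scale (\<lambda>z. f Xs z) \<and>
     (\<forall>i<p. \<forall>z.
        Vector_Spaces.linear scale scale (\<lambda>x. f (Xs[i := (x, snd (Xs ! i))]) z) \<and>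
        Vector_Spaces.linear scale scale (\<lambda>y. f (Xs[i := (fst (Xs ! i), y)]) z))}"

locale lie_triple_system = vector_space scale
  for scale :: "'k::field \<Rightarrow> 'v::ab_group_add \<Rightarrow> 'v" +
  fixes br :: "'v \<Rightarrow> 'v \<Rightarrow> 'v \<Rightarrow> 'v"
  assumes linear_1: "Vector_Spaces.linear scale scale (\<lambda>x. br x y z)"
    and linear_2: "Vector_Spaces.linear scale scale (\<lambda>y. br x y z)"
    and linear_3: "Vector_Spaces.linear scale scale (\<lambda>z. br x y z)"
    and alternating: "br x x y = 0"
    and cyclic: "br x y z + br y z x + br z x y = 0"
    and fundamental:
      "br x y (br z w u) = br (br x y z) w u + br z (br x y w) u + br z w (br x y u)"

definition LTS_cochains ::
  "('k::field \<Rightarrow> 'v::ab_group_add \<Rightarrow> 'v) \<Rightarrow> nat \<Rightarrow> 'v cochain set" where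
  "LTS_cochains scale n = {f \<in> Hom_tensor scale (n - 1). n \<ge> 2 \<longrightarrow>
     (\<forall>Xs x y z. length Xs = n - 2 \<longrightarrow>
        f (Xs @ [(x, x)]) y = 0 \<and>
        f (Xs @ [(x, y)]) z + f (Xs @ [(y, z)]) x + f (Xs @ [(z, x)]) y = 0)}"

definition ad :: "('v \<Rightarrow> 'v \<Rightarrow> 'v \<Rightarrow> 'v) \<Rightarrow> 'v \<Rightarrow> 'v \<Rightarrow> 'v \<Rightarrow> 'v" where
  "ad br x y z = br z x y"

text \<open>The tensor \<open>[x \<otimes> y, z \<otimes> w]\<close>, as the list of its two decomposable summands.\<close>

definition tensor_bracket ::
  "('v \<Rightarrow> 'v \<Rightarrow> 'v \<Rightarrow> 'v) \<Rightarrow> 'v \<times> 'v \<Rightarrow> 'v \<times> 'v \<Rightarrow> ('v \<times> 'v) list" where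
  "tensor_bracket br X Y =
     [(br (fst X) (snd X) (fst Y), snd Y), (fst Y, br (fst X) (snd X) (snd Y))]"

text \<open>
  Below, the index sets are those of the usual formulas: \<open>X i\<close> is the \<open>i\<close>-th pair of the list,
  counted from \<open>1\<close>, and \<open>X\<^sub>a, \<dots>, X\<^sub>b\<close> is \<open>map X [a..<b+1]\<close>.
\<close>

definition coboundary ::
  "('k::field \<Rightarrow> 'v::ab_group_add \<Rightarrow> 'v) \<Rightarrow> ('v \<Rightarrow> 'v \<Rightarrow> 'v \<Rightarrow> 'v) \<Rightarrow> nat \<Rightarrow> 'v cochain \<Rightarrow> 'v cochain"
where
  "coboundary scale br n f Xs z =
    (let X = (\<lambda>i. Xs ! (i - 1)); x = (\<lambda>i. fst (X i)); y = (\<lambda>i. snd (X i)); \<rho> = ad br in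
      (\<Sum>(j, k) \<in> {(j, k). 1 \<le> j \<and> j < k \<and> k \<le> n}. scale ((-1) ^ j)
         (\<Sum>Z \<leftarrow> tensor_bracket br (X j) (X k).
            f (map X (removeAll j [1..<k]) @ [Z] @ map X [k+1..<n+1]) z))
    + (\<Sum>j = 1..n. scale ((-1) ^ j) (f (map X (removeAll j [1..<n+1])) (br (x j) (y j) z)))
    + (\<Sum>j = 1..n. scale ((-1) ^ (j + 1))
         (\<rho> (y j) (x j) (f (map X (removeAll j [1..<n+1])) z)
          - \<rho> (x j) (y j) (f (map X (removeAll j [1..<n+1])) z)))
    + scale ((-1) ^ (n + 1))
         (\<rho> (y n) z (f (map X [1..<n]) (x n)) - \<rho> (x n) z (f (map X [1..<n]) (y n))))"

definition shuffles :: "nat \<Rightarrow> nat \<Rightarrow> (nat \<Rightarrow> nat) set" where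
  "shuffles a b = {\<sigma>. \<sigma> permutes {1..a+b} \<and>
     strict_mono_on {1..a} \<sigma> \<and> strict_mono_on {a+1..a+b} \<sigma>}"

text \<open>\<open>circ_k scale p q k P Q\<close> is \<open>P \<circ>\<^sub>k Q\<close> for \<open>P\<close>, \<open>Q\<close> of degrees \<open>p\<close>, \<open>q\<close> and \<open>1 \<le> k \<le> p + 1\<close>.\<close>

definition circ_k ::
  "('k::field \<Rightarrow> 'v::ab_group_add \<Rightarrow> 'v) \<Rightarrow> nat \<Rightarrow> nat \<Rightarrow> nat \<Rightarrow> 'v cochain \<Rightarrow> 'v cochain \<Rightarrow> 'v cochain"
where
  "circ_k scale p q k P Q Xs z =
    (let X = (\<lambda>i. Xs ! (i - 1)); x = (\<lambda>i. fst (X i)); y = (\<lambda>i. snd (X i)) in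
      if k \<le> p then
        (\<Sum>\<sigma> \<in> shuffles (k - 1) q. scale (of_int (sign \<sigma>))
           (P (map (\<lambda>i. X (\<sigma> i)) [1..<k]
               @ [(Q (map (\<lambda>i. X (\<sigma> i)) [k..<k+q]) (x (k+q)), y (k+q))]
               @ map X [k+q+1..<p+q+1]) z))
      + (\<Sum>\<sigma> \<in> shuffles (k - 1) q. scale (of_int (sign \<sigma>))
           (P (map (\<lambda>i. X (\<sigma> i)) [1..<k]
               @ [(x (k+q), Q (map (\<lambda>i. X (\<sigma> i)) [k..<k+q]) (y (k+q)))]
               @ map X [k+q+1..<p+q+1]) z))
      else
        (\<Sum>\<sigma> \<in> shuffles p q. scale (of_int (sign \<sigma>))
           (P (map (\<lambda>i. X (\<sigma> i)) [1..<p+1])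
              (Q (map (\<lambda>i. X (\<sigma> i)) [p+1..<p+q+1]) z))))"

definition circ ::
  "('k::field \<Rightarrow> 'v::ab_group_add \<Rightarrow> 'v) \<Rightarrow> nat \<Rightarrow> nat \<Rightarrow> 'v cochain \<Rightarrow> 'v cochain \<Rightarrow> 'v cochain" where
  "circ scale p q P Q Xs z =
     (\<Sum>k = 1..p+1. scale ((-1) ^ ((k - 1) * q)) (circ_k scale p q k P Q Xs z))"

definition cochain_bracket ::
  "('k::field \<Rightarrow> 'v::ab_group_add \<Rightarrow> 'v) \<Rightarrow> nat \<Rightarrow> nat \<Rightarrow> 'v cochain \<Rightarrow> 'v cochain \<Rightarrow> 'v cochain" where
  "cochain_bracket scale p q P Q Xs z =
     circ scale p q P Q Xs z - scale ((-1) ^ (p * q)) (circ scale q p Q P Xs z)"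

definition triple_cochain :: "('v \<Rightarrow> 'v \<Rightarrow> 'v \<Rightarrow> 'v) \<Rightarrow> 'v cochain" where
  "triple_cochain br Xs z = br (fst (Xs ! 0)) (snd (Xs ! 0)) z"

end

theory Submission
  imports Defs
begin

text \<open>
  Since \<open>\<pi>\<close> has degree 1, only shuffles of types \<open>(a, 1)\<close> and \<open>(1, b)\<close> contribute, apart from the
  trivial ones of type \<open>(0, b)\<close>.  Such a shuffle is increasing away from one point \<open>c\<close>, so it is
  determined by its value \<open>j\<close> at \<open>c\<close>, and its sign is \<open>(-1)\<^bsup>c + j\<^esup>\<close>.  Thus \<open>f \<circ> \<pi>\<close> gives the first
  two sums of the coboundary, \<open>\<pi> \<circ>\<^sub>2 f\<close> the third one (by the cyclic identity, which
  turns the adjoint terms into \<open>[x\<^sub>j, y\<^sub>j, \<cdot>]\<close>), and \<open>\<pi> \<circ>\<^sub>1 f\<close> the last term.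
\<close>

section \<open>Permutations increasing away from one point\<close>

text \<open>One notion for all the shuffles that occur: \<open>c = m\<close> gives type
  \<open>(m-1, 1)\<close>, \<open>c = 1\<close> gives type \<open>(1, m-1)\<close>, and
  \<open>c = 0\<close>, outside \<open>{1..m}\<close>, gives type \<open>(0, m)\<close>.\<close>

definition shuffles_at :: "nat \<Rightarrow> nat \<Rightarrow> (nat \<Rightarrow> nat) set" where
  "shuffles_at m c = {\<sigma>. \<sigma> permutes {1..m} \<and> strict_mono_on ({1..m} - {c}) \<sigma>}"

text \<open>Both lists are sorted and free of repetitions with the same elements, and such a list is
  determined by its set.\<close>

lemma map_shuffle_at:
  assumes "\<sigma> \<in> shuffles_at m c"
  shows "map \<sigma> (removeAll c [1..<m+1]) = removeAll (\<sigma> c) [1..<m+1]"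
proof (rule sorted_distinct_set_unique)
  have perm: "\<sigma> permutes {1..m}" and mono: "strict_mono_on ({1..m} - {c}) \<sigma>"
    using assms by (auto simp: shuffles_at_def)
  have set_upt: "set [1..<m+1] = {1..m}"
    by auto
  have sorted: "sorted (removeAll j [1..<m+1])" for j
    unfolding removeAll_filter_not_eq by (rule sorted_wrt_filter) (rule sorted_upt)
  have "sorted_wrt (\<lambda>x y. \<sigma> x \<le> \<sigma> y) (removeAll c [1..<m+1])"
    using sorted[of c]
    by (rule sorted_wrt_mono_rel[rotated], intro strict_mono_on_leD[OF mono])
      (simp_all only: set_removeAll set_upt)
  then show "sorted (map \<sigma> (removeAll c [1..<m+1]))"
    by (simp add: sorted_wrt_map)
  show "distinct (map \<sigma> (removeAll c [1..<m+1]))"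
    using permutes_inj[OF perm]
    by (simp only: distinct_map distinct_removeAll distinct_upt inj_on_subset[OF _ subset_UNIV])
  show "sorted (removeAll (\<sigma> c) [1..<m+1])" by (rule sorted)
  show "distinct (removeAll (\<sigma> c) [1..<m+1])" by (simp add: distinct_removeAll)
  show "set (map \<sigma> (removeAll c [1..<m+1])) = set (removeAll (\<sigma> c) [1..<m+1])"
    using permutes_image[OF perm] permutes_inj[OF perm] set_upt
    by (simp only: set_map set_removeAll image_set_diff image_insert image_empty)
qed

text \<open>The value at \<open>c\<close> determines the list of values at the other points of
  \<open>{1..m}\<close>; outside \<open>{1..m}\<close> both permutations are the identity.\<close>

lemma shuffle_at_unique:
  assumes "\<sigma> \<in> shuffles_at m c" "\<tau> \<in> shuffles_at m c" "\<sigma> c = \<tau> c"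
  shows "\<sigma> = \<tau>"
proof
  fix i
  have eq: "map \<sigma> (removeAll c [1..<m+1]) = map \<tau> (removeAll c [1..<m+1])"
    using assms by (simp only: map_shuffle_at)
  consider "i = c" | "i \<in> {1..m} - {c}" | "i \<notin> {1..m}"
    by blast
  then show "\<sigma> i = \<tau> i"
  proof cases
    case 2
    then have "i \<in> set (removeAll c [1..<m+1])" by auto
    with eq show ?thesis by (meson map_eq_conv)
  next
    case 3
    then show ?thesis
      using assms(1,2) by (auto simp: shuffles_at_def permutes_def)
  qed (use assms(3) in simp)
qed

text \<open>The value \<open>a\<close> is taken only at \<open>c\<close>. Away from \<open>c\<close>
  the swap therefore changes at most the value \<open>b\<close>, moving it to the free neighbour
  \<open>a\<close>, which preserves the order.\<close>

lemma transpose_shuffle_at: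
  assumes \<sigma>: "\<sigma> \<in> shuffles_at m c" and "a \<in> {1..m}" "b \<in> {1..m}"
    and "a = Suc b \<or> b = Suc a" and "\<sigma> c = a"
  shows "transpose a b \<circ> \<sigma> \<in> shuffles_at m c" "sign (transpose a b \<circ> \<sigma>) = - sign \<sigma>"
proof -
  have perm: "\<sigma> permutes {1..m}" and mono: "strict_mono_on ({1..m} - {c}) \<sigma>"
    using \<sigma> by (auto simp: shuffles_at_def)
  have ne: "\<sigma> i \<noteq> a" if "i \<noteq> c" for i
    using that assms(5) permutes_inj[OF perm] by (metis injD)
  have trans: "transpose a b u < transpose a b v" if "u < v" "u \<noteq> a" "v \<noteq> a" for u v
    using that assms(4) by (auto simp: transpose_def)
  have "strict_mono_on ({1..m} - {c}) (transpose a b \<circ> \<sigma>)"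
    by (rule strict_mono_onI) (use strict_mono_onD[OF mono] ne trans in auto)
  moreover have "transpose a b \<circ> \<sigma> permutes {1..m}"
    using perm assms(2,3) by (intro permutes_compose permutes_swap_id)
  ultimately show "transpose a b \<circ> \<sigma> \<in> shuffles_at m c"
    by (simp add: shuffles_at_def)
  have "permutation \<sigma>"
    using perm by (auto simp: permutation_permutes)
  then show "sign (transpose a b \<circ> \<sigma>) = - sign \<sigma>"
    using assms(4) by (auto simp: sign_compose permutation_swap_id sign_swap_id)
qed

text \<open>Start from the identity and move the value at \<open>c\<close> up or down to
  \<open>j\<close> by adjacent transpositions. Each one flips the sign, and the number of steps has
  the parity of \<open>c + j\<close>.\<close>

lemma ex_shuffle_at:
  assumes "c \<in> {1..m}" "j \<in> {1..m}"
  shows "\<exists>\<sigma> \<in> shuffles_at m c. \<sigma> c = j \<and> sign \<sigma> = (-1) ^ (c + j)"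
proof -
  let ?P = "\<lambda>j. \<exists>\<sigma> \<in> shuffles_at m c. \<sigma> c = j \<and> sign \<sigma> = (-1) ^ (c + j)"
  have base: "?P c"
    by (rule bexI[of _ id])
      (auto simp: shuffles_at_def permutes_id strict_mono_on_def sign_id simp flip: mult_2)
  have neighbour: "?P b" if "?P a" "a \<in> {1..m}" "b \<in> {1..m}" "a = Suc b \<or> b = Suc a" for a b
  proof -
    obtain \<sigma> where "\<sigma> \<in> shuffles_at m c" "\<sigma> c = a" "sign \<sigma> = (-1) ^ (c + a)"
      using \<open>?P a\<close> by blast
    then show ?thesis
      using transpose_shuffle_at[of \<sigma> m c a b] that(2-4)
      by (intro bexI[of _ "transpose a b \<circ> \<sigma>"]) auto
  qed
  show ?thesis
  proof (cases "c \<le> j")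
    case True
    then have "j \<le> m \<longrightarrow> ?P j"
    proof (induction rule: dec_induct)
      case (step k)
      then show ?case using assms(1) neighbour[of k "Suc k"] by auto
    qed (use base in simp)
    then show ?thesis using assms by simp
  next
    case False
    then have "j \<le> c" by simp
    then have "1 \<le> j \<longrightarrow> ?P j"
    proof (induction rule: inc_induct)
      case (step k)
      then show ?case using assms(1) neighbour[of "Suc k" k] by auto
    qed (use base in simp)
    then show ?thesis using assms by simp
  qed
qed

text \<open>The arguments of \<open>h\<close> are all that the summands of \<open>circ_k\<close> use
  of a shuffle: its sign, its value at \<open>c\<close> and the ordered list of the other values.
  Evaluation at \<open>c\<close> is a bijection onto \<open>{1..m}\<close>, which reindexes the
  sum.\<close>

lemma sum_shuffles_at:
  fixes h :: "int \<Rightarrow> nat \<Rightarrow> nat list \<Rightarrow> 'a::comm_monoid_add"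
  assumes c: "c \<in> {1..m}"
  shows "(\<Sum>\<sigma> \<in> shuffles_at m c. h (sign \<sigma>) (\<sigma> c) (map \<sigma> (removeAll c [1..<m+1])))
       = (\<Sum>j = 1..m. h ((-1) ^ (c + j)) j (removeAll j [1..<m+1]))"
proof -
  have uniq: "\<sigma> = \<tau>" if "\<sigma> \<in> shuffles_at m c" "\<tau> \<in> shuffles_at m c" "\<sigma> c = \<tau> c" for \<sigma> \<tau>
    using that by (rule shuffle_at_unique)
  have sign: "sign \<sigma> = (-1) ^ (c + \<sigma> c)" and mem: "\<sigma> c \<in> {1..m}" if "\<sigma> \<in> shuffles_at m c" for \<sigma>
  proof -
    show "\<sigma> c \<in> {1..m}"
      using that c permutes_in_image[of \<sigma> "{1..m}" c] by (simp add: shuffles_at_def)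
    \<comment> \<open>The sign is known for the constructed shuffle with the same value at
      \<open>c\<close>; by uniqueness that shuffle is \<open>\<sigma>\<close> itself.\<close>
    from ex_shuffle_at[OF c this] obtain \<tau>
      where "\<tau> \<in> shuffles_at m c" "\<tau> c = \<sigma> c" "sign \<tau> = (-1) ^ (c + \<sigma> c)"
      by blast
    with uniq[OF this(1) that this(2)] show "sign \<sigma> = (-1) ^ (c + \<sigma> c)"
      by simp
  qed
  have bij: "bij_betw (\<lambda>\<sigma>. \<sigma> c) (shuffles_at m c) {1..m}"
    unfolding bij_betw_def
  proof
    show "inj_on (\<lambda>\<sigma>. \<sigma> c) (shuffles_at m c)"
      by (rule inj_onI) (rule uniq)
    show "(\<lambda>\<sigma>. \<sigma> c) ` shuffles_at m c = {1..m}"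
    proof
      show "(\<lambda>\<sigma>. \<sigma> c) ` shuffles_at m c \<subseteq> {1..m}"
        using mem by blast
      show "{1..m} \<subseteq> (\<lambda>\<sigma>. \<sigma> c) ` shuffles_at m c"
        using ex_shuffle_at[OF c] by blast
    qed
  qed
  have "(\<Sum>\<sigma> \<in> shuffles_at m c. h (sign \<sigma>) (\<sigma> c) (map \<sigma> (removeAll c [1..<m+1])))
      = (\<Sum>\<sigma> \<in> shuffles_at m c. h ((-1) ^ (c + \<sigma> c)) (\<sigma> c) (removeAll (\<sigma> c) [1..<m+1]))"
    by (rule sum.cong[OF refl]) (simp only: sign map_shuffle_at)
  also have "\<dots> = (\<Sum>j = 1..m. h ((-1) ^ (c + j)) j (removeAll j [1..<m+1]))"
    by (rule sum.reindex_bij_betw[OF bij])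
  finally show ?thesis .
qed

section \<open>Shuffles of types \<open>(0, b)\<close>, \<open>(a, 1)\<close> and
  \<open>(1, b)\<close>\<close>

lemma shuffles_0_left: "shuffles 0 b = {id}"
proof -
  \<comment> \<open>the exceptional point \<open>0\<close> lies outside \<open>{1..b}\<close>, so nothing is exempt from monotonicity\<close>
  have "shuffles 0 b = shuffles_at b 0"
    by (auto simp: shuffles_def shuffles_at_def)
  moreover have "id \<in> shuffles_at b 0"
    by (auto simp: shuffles_at_def permutes_id strict_mono_on_def)
  moreover have "\<sigma> 0 = id 0" if "\<sigma> \<in> shuffles_at b 0" for \<sigma>
    using that by (auto simp: shuffles_at_def permutes_def)
  ultimately show ?thesis
    using shuffle_at_unique by blast
qed

text \<open>The second block is the single point \<open>a+1\<close>, where monotonicity is vacuous,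
  so \<open>a+1\<close> is the exceptional point.\<close>

lemma sum_shuffles_1_right:
  fixes h :: "int \<Rightarrow> nat \<Rightarrow> nat list \<Rightarrow> 'a::comm_monoid_add"
  shows "(\<Sum>\<sigma> \<in> shuffles a 1. h (sign \<sigma>) (\<sigma> (a+1)) (map \<sigma> [1..<a+1]))
       = (\<Sum>j = 1..a+1. h ((-1) ^ (a+1+j)) j (removeAll j [1..<a+2]))"
proof -
  have "{1..a+1} - {a+1} = {1..a}"
    by auto
  then have "shuffles a 1 = shuffles_at (a+1) (a+1)"
    by (simp add: shuffles_def shuffles_at_def strict_mono_on_def del: One_nat_def)
  moreover have "removeAll (a+1) [1..<a+1+1] = [1..<a+1]"
    by simp
  moreover have "a + 2 = a + 1 + 1"
    by simp
  ultimately show ?thesis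
    using sum_shuffles_at[of "a+1" "a+1" h, unfolded atLeastAtMost_iff]
    by (simp only: le_add2 order_refl simp_thms True_implies_equals)
qed

lemma sum_shuffles_1_left:
  fixes h :: "int \<Rightarrow> nat \<Rightarrow> nat list \<Rightarrow> 'a::comm_monoid_add"
  shows "(\<Sum>\<sigma> \<in> shuffles 1 b. h (sign \<sigma>) (\<sigma> 1) (map \<sigma> [2..<b+2]))
       = (\<Sum>j = 1..b+1. h ((-1) ^ (1+j)) j (removeAll j [1..<b+2]))"
proof -
  have "{1..b+1} - {1} = {2..b+1}"
    by auto
  then have "shuffles 1 b = shuffles_at (b+1) 1"
    by (simp add: shuffles_def shuffles_at_def strict_mono_on_def numeral_2_eq_2)
  moreover have "removeAll 1 [1..<b+1+1] = [2..<b+1+1]"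
    by (subst upt_conv_Cons) (auto simp: numeral_2_eq_2)
  moreover have "b + 2 = b + 1 + 1"
    by simp
  ultimately show ?thesis
    using sum_shuffles_at[of 1 "b+1" h, unfolded atLeastAtMost_iff]
    by (simp only: le_add2 order_refl simp_thms True_implies_equals)
qed

text \<open>The left index set is that of the coboundary. On the right, \<open>k\<close> is the slot
  of a partial composition with \<open>\<pi>\<close>, which alters the pair \<open>k+1\<close>, and
  \<open>j\<close> is the value of a shuffle at its exceptional point.\<close>

lemma sum_pairs_less:
  fixes g :: "nat \<Rightarrow> nat \<Rightarrow> 'a::comm_monoid_add"
  shows "(\<Sum>(j, k) \<in> {(j, k). 1 \<le> j \<and> j < k \<and> k \<le> q+1}. g j k) = (\<Sum>k = 1..q. \<Sum>j = 1..k. g j (k+1))"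
proof -
  have "(\<Sum>k = 1..q. \<Sum>j = 1..k. g j (k+1)) = (\<Sum>(k, j) \<in> Sigma {1..q} (\<lambda>k. {1..k}). g j (k+1))"
    by (simp add: sum.Sigma)
  also have "\<dots> = (\<Sum>(j, k) \<in> {(j, k). 1 \<le> j \<and> j < k \<and> k \<le> q+1}. g j k)"
    by (rule sum.reindex_bij_witness[where i = "\<lambda>(j, k). (k - 1, j)" and j = "\<lambda>(k, j). (j, k+1)"])
      auto
  finally show ?thesis ..
qed

section \<open>Skew symmetry, the adjoint representation and signs\<close>

context lie_triple_system
begin

lemma br_swap: "br y x z = - br x y z"
proof -
  \<comment> \<open>Polarization: the left side and both diagonal terms vanish by
    \<open>alternating\<close>.\<close>
  have "br (x + y) (x + y) z = br x x z + br x y z + (br y x z + br y y z)"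
    using module_hom.add[OF module_hom_iff_linear[THEN iffD2, OF linear_1]]
      module_hom.add[OF module_hom_iff_linear[THEN iffD2, OF linear_2]]
    by (simp add: algebra_simps)
  then show ?thesis
    by (simp add: alternating eq_neg_iff_add_eq_0 add.commute)
qed

text \<open>The left side is \<open>br z y x - br z x y\<close>; skew symmetry makes this
  \<open>- br y z x - br z x y\<close>, and \<open>cyclic\<close> applies.\<close>

lemma ad_diff: "ad br y x z - ad br x y z = br x y z"
  using cyclic[of x y z] br_swap[of y z x]
  by (simp add: ad_def algebra_simps)

lemma scale_sign_sign: "scale ((-1) ^ p) (scale ((-1) ^ p) v) = v"
  by (simp flip: power_mult_distrib)

text \<open>Here \<open>(-1) ^ p\<close> is the weight of slot \<open>p+1\<close> in a composition
  with a map of degree 1, and \<open>(-1) ^ (p+1+j)\<close> is the sign of a shuffle of type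
  \<open>(p, 1)\<close>. Their product is \<open>- (-1) ^ j\<close>.\<close>

lemma scale_sum_sign:
  "scale ((-1) ^ p) (\<Sum>j \<in> A. scale ((-1) ^ (p+1+j)) (g j)) = - (\<Sum>j \<in> A. scale ((-1) ^ j) (g j))"
proof -
  have "scale ((-1) ^ (p+1+j)) (g j) = scale ((-1) ^ p) (- scale ((-1) ^ j) (g j))" for j
    by (simp add: power_add)
  then show ?thesis
    by (simp only: scale_sum_right[symmetric] scale_sign_sign sum_negf)
qed

section \<open>The compositions of \<open>\<pi>\<close> and \<open>f\<close> in both orders\<close>

text \<open>Only two slots exist: slot 1 involves just the identity shuffle, and slot 2, of weight
  \<open>(-1) ^ q\<close>, the shuffles of type \<open>(1, q)\<close>.\<close>

lemma circ_triple_left: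
  fixes Xs :: "('v \<times> 'v) list"
  defines "X \<equiv> \<lambda>i. Xs ! (i - 1)"
  shows "circ scale 1 q (triple_cochain br) f Xs z =
     br (f (map X [1..<q+1]) (fst (X (q+1)))) (snd (X (q+1))) z
   + br (fst (X (q+1))) (f (map X [1..<q+1]) (snd (X (q+1)))) z
   + scale ((-1) ^ q) (\<Sum>j = 1..q+1. scale ((-1) ^ (1+j))
       (br (fst (X j)) (snd (X j)) (f (map X (removeAll j [1..<q+2])) z)))"
proof -
  have upt: "[1..<2] = [1::nat]"
    by (simp add: numeral_2_eq_2)
  have "circ_k scale 1 q 1 (triple_cochain br) f Xs z =
     br (f (map X [1..<q+1]) (fst (X (q+1)))) (snd (X (q+1))) z
   + br (fst (X (q+1))) (f (map X [1..<q+1]) (snd (X (q+1)))) z"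
    by (simp add: circ_k_def Let_def shuffles_0_left triple_cochain_def X_def
        del: upt_Suc)
  moreover have "circ_k scale 1 q 2 (triple_cochain br) f Xs z =
     (\<Sum>\<sigma> \<in> shuffles 1 q. scale (of_int (sign \<sigma>))
       (br (fst (X (\<sigma> 1))) (snd (X (\<sigma> 1))) (f (map X (map \<sigma> [2..<q+2])) z)))"
    by (simp add: circ_k_def Let_def triple_cochain_def X_def upt comp_def numeral_2_eq_2 del: upt_Suc)
  moreover have "\<dots> = (\<Sum>j = 1..q+1. scale ((-1) ^ (1+j))
       (br (fst (X j)) (snd (X j)) (f (map X (removeAll j [1..<q+2])) z)))"
    by (subst sum_shuffles_1_left[where h = "\<lambda>s j L. scale (of_int s)
       (br (fst (X j)) (snd (X j)) (f (map X L) z))"]) simp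
  moreover have "circ scale 1 q (triple_cochain br) f Xs z = circ_k scale 1 q 1 (triple_cochain br) f Xs z
      + scale ((-1) ^ q) (circ_k scale 1 q 2 (triple_cochain br) f Xs z)"
    by (simp add: circ_def numeral_2_eq_2)
  ultimately show ?thesis
    by (simp only:)
qed

text \<open>Slots up to \<open>q\<close> insert the bracket into a pair and give the sum over
  \<open>j < k\<close>; slot \<open>q+1\<close> inserts it into the last argument and gives the
  other sum.\<close>

lemma circ_triple_right:
  fixes Xs :: "('v \<times> 'v) list"
  defines "X \<equiv> \<lambda>i. Xs ! (i - 1)"
  shows "circ scale q 1 f (triple_cochain br) Xs z =
     - (\<Sum>(j, k) \<in> {(j, k). 1 \<le> j \<and> j < k \<and> k \<le> q+1}. scale ((-1) ^ j)
         (\<Sum>Z \<leftarrow> tensor_bracket br (X j) (X k).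
            f (map X (removeAll j [1..<k]) @ [Z] @ map X [k+1..<q+2]) z))
     - (\<Sum>j = 1..q+1. scale ((-1) ^ j)
         (f (map X (removeAll j [1..<q+2])) (br (fst (X j)) (snd (X j)) z)))"
proof -
  let ?g = "\<lambda>j k. \<Sum>Z \<leftarrow> tensor_bracket br (X j) (X k).
            f (map X (removeAll j [1..<k]) @ [Z] @ map X [k+1..<q+2]) z"
  have inner: "scale ((-1) ^ (k - 1)) (circ_k scale q 1 k f (triple_cochain br) Xs z)
      = - (\<Sum>j = 1..k. scale ((-1) ^ j) (?g j (k+1)))" if "k \<in> {1..q}" for k
  proof -
    define a where "a = k - 1"
    with that have k: "k = a + 1"
      by simp
    \<comment> \<open>The two shuffle sums in \<open>circ_k\<close>, one for each entry of the pair
      \<open>k+1\<close>, merge into one sum over the two summands of the tensor bracket.\<close>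
    have "circ_k scale q 1 k f (triple_cochain br) Xs z =
      (\<Sum>\<sigma> \<in> shuffles a 1. scale (of_int (sign \<sigma>))
        (\<Sum>Z \<leftarrow> tensor_bracket br (X (\<sigma> (a+1))) (X (k+1)).
            f (map X (map \<sigma> [1..<a+1]) @ [Z] @ map X [k+2..<q+2]) z))"
      using that
      by (simp add: circ_k_def Let_def triple_cochain_def tensor_bracket_def X_def k comp_def
          scale_right_distrib sum.distrib numeral_2_eq_2 del: upt_Suc)
    also have "\<dots> = (\<Sum>j = 1..a+1. scale ((-1) ^ (a+1+j))
        (\<Sum>Z \<leftarrow> tensor_bracket br (X j) (X (k+1)).
            f (map X (removeAll j [1..<a+2]) @ [Z] @ map X [k+2..<q+2]) z))"
      by (subst sum_shuffles_1_right[where h = "\<lambda>s j L. scale (of_int s)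
        (\<Sum>Z \<leftarrow> tensor_bracket br (X j) (X (k+1)).
            f (map X L @ [Z] @ map X [k+2..<q+2]) z)"]) simp
    \<comment> \<open>Since \<open>a+2 = k+1\<close>, the remaining pairs are those before the
      altered pair \<open>k+1\<close>, as in \<open>?g j (k+1)\<close>.\<close>
    also have "\<dots> = (\<Sum>j = 1..k. scale ((-1) ^ (k+j)) (?g j (k+1)))"
      by (simp add: k numeral_2_eq_2 del: upt_Suc)
    finally show ?thesis
      using scale_sum_sign[of a "\<lambda>j. ?g j (k+1)" "{1..k}"] by (simp only: k add_diff_cancel_right')
  qed
  have "circ_k scale q 1 (q+1) f (triple_cochain br) Xs z =
      (\<Sum>\<sigma> \<in> shuffles q 1. scale (of_int (sign \<sigma>))
        (f (map X (map \<sigma> [1..<q+1])) (br (fst (X (\<sigma> (q+1)))) (snd (X (\<sigma> (q+1)))) z)))"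
    by (simp add: circ_k_def Let_def triple_cochain_def X_def comp_def del: upt_Suc)
  also have "\<dots> = (\<Sum>j = 1..q+1. scale ((-1) ^ (q+1+j))
        (f (map X (removeAll j [1..<q+2])) (br (fst (X j)) (snd (X j)) z)))"
    by (subst sum_shuffles_1_right[where h = "\<lambda>s j L. scale (of_int s)
        (f (map X L) (br (fst (X j)) (snd (X j)) z))"]) simp
  finally have last: "scale ((-1) ^ q) (circ_k scale q 1 (q+1) f (triple_cochain br) Xs z) =
      - (\<Sum>j = 1..q+1. scale ((-1) ^ j)
        (f (map X (removeAll j [1..<q+2])) (br (fst (X j)) (snd (X j)) z)))"
    by (simp only: scale_sum_sign)
  have "circ scale q 1 f (triple_cochain br) Xs z =
      (\<Sum>k = 1..q. scale ((-1) ^ (k - 1)) (circ_k scale q 1 k f (triple_cochain br) Xs z))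
      + scale ((-1) ^ q) (circ_k scale q 1 (q+1) f (triple_cochain br) Xs z)"
    by (simp add: circ_def)
  also have "\<dots> = - (\<Sum>k = 1..q. \<Sum>j = 1..k. scale ((-1) ^ j) (?g j (k+1)))
      - (\<Sum>j = 1..q+1. scale ((-1) ^ j)
        (f (map X (removeAll j [1..<q+2])) (br (fst (X j)) (snd (X j)) z)))"
    by (simp only: sum.cong[OF refl inner] last sum_negf diff_conv_add_uminus)
  also note sum_pairs_less[of "\<lambda>j k. scale ((-1) ^ j) (?g j k)" q, symmetric]
  finally show ?thesis .
qed

section \<open>Comparison with the coboundary\<close>

text \<open>The outer \<open>(-1) ^ q\<close> cancels the sign in front of
  \<open>f \<circ> \<pi>\<close> up to a minus and the weight of slot 2 of
  \<open>\<pi> \<circ> f\<close>. On slot 1 it survives, and it equals the sign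
  \<open>(-1) ^ (n+1)\<close> of the last coboundary term, as \<open>n = q+1\<close>.\<close>

lemma coboundary_eq_bracket:
  "coboundary scale br (q+1) f Xs z =
     scale ((-1) ^ q) (cochain_bracket scale 1 q (triple_cochain br) f Xs z)"
proof -
  \<comment> \<open>With \<open>u\<close> and \<open>v\<close> the values of \<open>f\<close> at
    \<open>x\<close> and \<open>y\<close> as last argument, this turns the last coboundary term into
    slot 1 of \<open>\<pi> \<circ> f\<close>.\<close>
  have last_term: "ad br y z u - ad br x z v = br u y z + br x v z" for x y u v
    using br_swap[of x v z] by (simp add: ad_def)
  have arith: "(-1) ^ (q+2) = ((-1) ^ q :: 'k)" "q+1+1 = q+2" "1+j = j+1" for j :: nat
    by simp_all
  show ?thesis
    unfolding coboundary_def cochain_bracket_def Let_def circ_triple_left circ_triple_right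
      mult_1 add_diff_cancel_right' arith
    unfolding ad_diff last_term
    by (simp only: scale_right_diff_distrib scale_right_distrib scale_minus_right scale_sign_sign)
      (simp add: ac_simps del: upt_Suc sum.cl_ivl_Suc One_nat_def)
qed

end

theorem theorem2p8:
  fixes scale :: "'k::field \<Rightarrow> 'v::ab_group_add \<Rightarrow> 'v"
    and br :: "'v \<Rightarrow> 'v \<Rightarrow> 'v \<Rightarrow> 'v"
    and f :: "'v cochain"
    and n :: nat
  assumes "lie_triple_system scale br"
    and "n \<ge> 1"
    and "f \<in> LTS_cochains scale n"
  shows "\<forall>Xs z. length Xs = n \<longrightarrow>
    coboundary scale br n f Xs z
      = scale ((-1) ^ (n - 1)) (cochain_bracket scale 1 (n - 1) (triple_cochain br) f Xs z)"
proof -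
  \<comment> \<open>\<open>q\<close> is the degree of \<open>f\<close>.\<close>
  obtain q where "n = q + 1"
    using assms(2) by (metis le_add_diff_inverse2)
  show ?thesis
    unfolding \<open>n = q + 1\<close> add_diff_cancel_right'
    by (intro allI impI) (rule lie_triple_system.coboundary_eq_bracket[OF assms(1)])
qed

end
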